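(* Let $q$ be a prime power and $k$ a non-negative integer. Let $M$ be a simple $GF(q)$-matroid with no coloops that has two $k$-loose elements $e$ and $f$. Then $r(M) \leq (q+1)(k-1)+2q$, or $\{e,f\}$ is a cocircuit of $M$.
   Context: A $GF(q)$-matroid is a matroid representable over the field with $q$ elements. For a matroid $M$ of rank $r$ and a non-negative integer $k$, an element $t$ of $M$ is called $k$-loose if every circuit of $M$ that contains $t$ has size greater than $r-k$. A matroid is simple if it has no loops and no parallel pairs. *)

theory Defs
  imports
    "HOL-Number_Theory.Prime_Powers"
    "Jordan_Normal_Form.Missing_VectorSpace"
begin

record 'a set_system =
  ground :: "'a set"
  indep :: "'a set \<Rightarrow> bool"

definition matroid :: "'a set_system \<Rightarrow> bool" where
  "matroid M \<longleftrightarrow>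
     finite (ground M) \<and>
     (\<forall>X. indep M X \<longrightarrow> X \<subseteq> ground M) \<and>
     indep M {} \<and>
     (\<forall>X Y. indep M X \<longrightarrow> Y \<subseteq> X \<longrightarrow> indep M Y) \<and>
     (\<forall>X Y. indep M X \<longrightarrow> indep M Y \<longrightarrow> card X < card Y \<longrightarrow>
        (\<exists>y \<in> Y - X. indep M (insert y X)))"

definition basis :: "'a set_system \<Rightarrow> 'a set \<Rightarrow> bool" where
  "basis M B \<longleftrightarrow> indep M B \<and> (\<forall>X. indep M X \<longrightarrow> B \<subseteq> X \<longrightarrow> X = B)"

definition circuit :: "'a set_system \<Rightarrow> 'a set \<Rightarrow> bool" where
  "circuit M C \<longleftrightarrow> C \<subseteq> ground M \<and> \<not> indep M C \<and> (\<forall>X. X \<subset> C \<longrightarrow> indep M X)"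

definition rank :: "'a set_system \<Rightarrow> nat" where
  "rank M = Max {card X | X. indep M X}"

text \<open>The bases of the dual are the complements of the bases of \<open>M\<close>.\<close>

definition dual :: "'a set_system \<Rightarrow> 'a set_system" where
  "dual M = \<lparr> ground = ground M, indep = (\<lambda>X. \<exists>B. basis M B \<and> X \<subseteq> ground M - B) \<rparr>"

definition loop :: "'a set_system \<Rightarrow> 'a \<Rightarrow> bool" where
  "loop M x \<longleftrightarrow> circuit M {x}"

definition parallel_pair :: "'a set_system \<Rightarrow> 'a \<Rightarrow> 'a \<Rightarrow> bool" where
  "parallel_pair M x y \<longleftrightarrow> x \<noteq> y \<and> circuit M {x, y}"

definition simple_matroid :: "'a set_system \<Rightarrow> bool" where
  "simple_matroid M \<longleftrightarrow>
     matroid M \<and> (\<forall>x. \<not> loop M x) \<and> (\<forall>x y. \<not> parallel_pair M x y)"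

definition cocircuit :: "'a set_system \<Rightarrow> 'a set \<Rightarrow> bool" where
  "cocircuit M C \<longleftrightarrow> circuit (dual M) C"

definition coloop :: "'a set_system \<Rightarrow> 'a \<Rightarrow> bool" where
  "coloop M x \<longleftrightarrow> loop (dual M) x"

text \<open>The difference is taken in the integers, since \<open>k\<close> may exceed the rank.\<close>

definition loose :: "nat \<Rightarrow> 'a set_system \<Rightarrow> 'a \<Rightarrow> bool" where
  "loose k M t \<longleftrightarrow> t \<in> ground M \<and>
     (\<forall>C. circuit M C \<longrightarrow> t \<in> C \<longrightarrow> int (card C) > int (rank M) - int k)"

text \<open>
  A representation labels the elements of \<open>M\<close> by vectors of a vector space over \<open>F\<close>.
  Independence is that of the labelled family, hence the injectivity condition.
  Fixing the type of vectors to \<open>nat \<Rightarrow> 'f\<close> loses nothing: the labels span a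
  finite-dimensional space, which is isomorphic to some space of \<open>n\<close>-tuples over \<open>F\<close>.
\<close>

definition representable_over :: "('f, 'm) ring_scheme \<Rightarrow> 'a set_system \<Rightarrow> bool" where
  "representable_over F M \<longleftrightarrow>
     (\<exists>(V :: ('f, nat \<Rightarrow> 'f) module) \<phi>.
        vectorspace F V \<and>
        \<phi> \<in> ground M \<rightarrow> carrier V \<and>
        (\<forall>X \<subseteq> ground M. indep M X \<longleftrightarrow>
           inj_on \<phi> X \<and> \<not> module.lin_dep F V (\<phi> ` X)))"

end

theory Submission
  imports Defs
begin

text \<open>
  Suppose that \<open>{e, f}\<close> is not a cocircuit. As there are no coloops, it is coindependent, so some
  basis \<open>B\<close> avoids \<open>e\<close> and \<open>f\<close>. The linear relations on \<open>W = B \<union> {e, f}\<close> form a space of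
  dimension two, hence up to scalars there are \<open>q + 1\<close> of them, and each element of \<open>W\<close> has
  coefficient zero in at least one of them. On the other hand the support of a nonzero relation
  contains a circuit, which meets \<open>{e, f}\<close> because \<open>B\<close> is independent; by looseness at most
  \<open>k + 1\<close> of the \<open>r + 2\<close> elements of \<open>W\<close> are outside the support.
  Thus \<open>r + 2 \<le> (q + 1) (k + 1)\<close>, which is the claimed bound.
\<close>

section \<open>Circuits, bases and coindependent pairs\<close>

lemma dependent_contains_circuit:
  assumes "matroid M" "S \<subseteq> ground M" "\<not> indep M S"
  obtains C where "C \<subseteq> S" "circuit M C"
proof -
  have "finite S"
    using assms by (auto simp: matroid_def intro: finite_subset)
  then have "\<exists>C\<subseteq>S. circuit M C"
    using assms(2,3)
  proof (induction S rule: finite_psubset_induct)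
    case (psubset S)
    show ?case
    proof (cases "circuit M S")
      case False
      then obtain X where "X \<subset> S" "\<not> indep M X"
        using psubset.prems by (auto simp: circuit_def)
      then show ?thesis
        using psubset.IH[of X] psubset.prems by blast
    qed auto
  qed
  then show thesis
    using that by blast
qed

lemma basis_card_eq_rank:
  assumes "matroid M" "basis M B"
  shows "card B = rank M"
proof -
  have le: "card X \<le> card B" if X: "indep M X" for X
  proof (rule ccontr)
    assume "\<not> card X \<le> card B"
    then have "card B < card X" by simp
    moreover have "indep M B"
      using assms(2) by (simp add: basis_def)
    moreover have "\<forall>X Y. indep M X \<longrightarrow> indep M Y \<longrightarrow> card X < card Y \<longrightarrow>
        (\<exists>y \<in> Y - X. indep M (insert y X))"
      using assms(1) by (simp add: matroid_def)
    ultimately obtain y where "y \<in> X - B" "indep M (insert y B)"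
      using X by blast
    then show False
      using assms(2) unfolding basis_def by blast
  qed
  have "rank M = card B"
    unfolding rank_def
  proof (rule Max_eqI)
    show "finite {card X |X. indep M X}"
      by (rule finite_subset[of _ "{..card B}"]) (use le in auto)
  qed (use le assms(2) in \<open>auto simp: basis_def\<close>)
  then show ?thesis by simp
qed

lemma basis_exists:
  assumes "matroid M"
  obtains B where "basis M B"
proof -
  have "finite {X. indep M X}"
    by (rule finite_subset[of _ "Pow (ground M)"]) (use assms in \<open>auto simp: matroid_def\<close>)
  moreover have "{} \<in> {X. indep M X}"
    using assms by (auto simp: matroid_def)
  ultimately obtain B where "B \<in> {X. indep M X}" "\<forall>X\<in>{X. indep M X}. B \<le> X \<longrightarrow> B = X"
    using finite_has_maximal[of "{X. indep M X}"] by blast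
  then have "basis M B"
    unfolding basis_def by auto
  then show thesis using that by blast
qed

text \<open>Without coloops, every proper subset of \<open>{e, f}\<close> is independent in the
  dual. Were the pair dependent there, it would be a circuit of the dual, that is, a cocircuit. So
  it is coindependent, which by the definition of \<open>dual\<close> yields the basis.\<close>

lemma not_cocircuit_pair_imp_avoiding_basis:
  assumes "matroid M" "e \<in> ground M" "f \<in> ground M"
    and "\<not> coloop M e" "\<not> coloop M f" "\<not> cocircuit M {e, f}"
  obtains B where "basis M B" "e \<notin> B" "f \<notin> B"
proof -
  have empty: "indep (dual M) {}"
    using basis_exists[OF assms(1)] by (auto simp: dual_def)
  have ground: "ground (dual M) = ground M"
    by (simp add: dual_def)
  have single: "indep (dual M) {x}" if "x \<in> ground M" "\<not> coloop M x" for x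
    using that empty ground by (auto simp: coloop_def loop_def circuit_def psubset_eq subset_singleton_iff)
  have "indep (dual M) X" if "X \<subset> {e, f}" for X
  proof -
    have "X = {} \<or> X = {e} \<or> X = {f}"
      using that by auto
    then show ?thesis
      using empty single assms by auto
  qed
  then have "indep (dual M) {e, f}"
    using assms(2,3,6) ground unfolding cocircuit_def circuit_def by auto
  then show thesis
    using that by (auto simp: dual_def)
qed

text \<open>A circuit inside \<open>S\<close> cannot lie in \<open>B\<close>, so looseness gives it
  at least r - k + 1 elements. The set has r + 2 elements, which leaves at most k + 1 outside
  \<open>S\<close>.\<close>

lemma card_outside_dependent_le:
  assumes "matroid M" "basis M B" "e \<notin> B" "f \<notin> B" "e \<noteq> f" "loose k M e" "loose k M f"
    and "S \<subseteq> insert e (insert f B)" "\<not> indep M S"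
  shows "card (insert e (insert f B) - S) \<le> k + 1"
proof -
  let ?W = "insert e (insert f B)"
  have B: "B \<subseteq> ground M" "indep M B"
    using assms(1,2) by (auto simp: matroid_def basis_def)
  have W: "?W \<subseteq> ground M"
    using B assms(6,7) by (auto simp: loose_def)
  have finW: "finite ?W"
    using W assms(1) by (auto simp: matroid_def intro: finite_subset)
  obtain C where C: "C \<subseteq> S" "circuit M C"
    using dependent_contains_circuit[OF assms(1) subset_trans[OF assms(8) W] assms(9)] .
  have "\<not> C \<subseteq> B"
    using B(2) C(2) assms(1) unfolding circuit_def matroid_def by metis
  then have "e \<in> C \<or> f \<in> C"
    using C assms(8) by blast
  then have "int (card C) > int (rank M) - int k"
    using C assms(6,7) by (auto simp: loose_def)
  moreover have "card C \<le> card S"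
    using C finW assms(8) by (meson card_mono finite_subset)
  moreover have "card ?W = rank M + 2"
    using basis_card_eq_rank[OF assms(1,2)] finW assms(3-5) by auto
  moreover have "card (?W - S) = card ?W - card S" "card S \<le> card ?W"
    using finW assms(8) by (simp_all add: card_Diff_subset card_mono finite_subset)
  ultimately show ?thesis by linarith
qed

section \<open>Linear combinations and spans\<close>

context vectorspace
begin

lemma span_smult:
  assumes "U \<subseteq> carrier V" "c \<in> carrier K" "v \<in> span U"
  shows "c \<odot>\<^bsub>V\<^esub> v \<in> span U"
  using submodule.smult_closed[OF span_is_submodule[OF assms(1)] assms(2,3)] .

text \<open>Terms with coefficient zero contribute nothing. This is how the support of a relation,
  rather than all of \<open>B\<close>, is seen to span a vector.\<close>

lemma lincomb_in_span_support:
  assumes "finite A" "A \<subseteq> carrier V" "a \<in> A \<rightarrow> carrier K"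
    and "\<And>v. v \<in> A \<Longrightarrow> a v \<noteq> \<zero>\<^bsub>K\<^esub> \<Longrightarrow> v \<in> U" and "U \<subseteq> carrier V"
  shows "lincomb a A \<in> span U"
  using assms
proof (induction A rule: finite_induct)
  case empty
  then show ?case by (simp add: span_zero)
next
  case (insert v A)
  have "lincomb a (insert v A) = a v \<odot>\<^bsub>V\<^esub> v \<oplus>\<^bsub>V\<^esub> lincomb a A"
    using insert.prems insert.hyps by (intro lincomb_insert2) auto
  moreover have "lincomb a A \<in> span U"
    using insert by auto
  moreover have "a v \<odot>\<^bsub>V\<^esub> v \<in> span U"
  proof (cases "a v = \<zero>\<^bsub>K\<^esub>")
    case True
    then show ?thesis using insert.prems by (simp add: span_zero)
  next
    case False
    then show ?thesis using insert.prems by (intro span_smult span_mem) auto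
  qed
  ultimately show ?case
    using span_add1 insert.prems by simp
qed

lemma lin_dep_image_if_in_span:
  assumes "finite S" "\<phi> ` S \<subseteq> carrier V" "inj_on \<phi> S" "x \<in> S" "\<phi> x \<in> span (\<phi> ` (S - {x}))"
  shows "lin_dep (\<phi> ` S)"
proof -
  have "\<phi> ` (S - {x}) = \<phi> ` S - {\<phi> x}"
    using assms(3,4) by (auto simp: inj_on_def)
  then show ?thesis
    using assms lindep_span[of "\<phi> ` S"] by auto
qed

end

section \<open>Matroids labelled by vectors\<close>

locale represented_matroid = vectorspace K V
  for K :: "('f, 'm) ring_scheme" and V :: "('f, 'v, 'n) module_scheme" +
  fixes M :: "'a set_system" and \<phi> :: "'a \<Rightarrow> 'v"
  assumes matroid: "matroid M"
    and labels: "\<phi> \<in> ground M \<rightarrow> carrier V"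
    and indep_iff: "X \<subseteq> ground M \<Longrightarrow> indep M X \<longleftrightarrow> inj_on \<phi> X \<and> lin_indpt (\<phi> ` X)"
begin

text \<open>If two elements of \<open>S\<close> share a label, \<open>S\<close> is dependent by
  \<open>indep_iff\<close>; otherwise \<open>\<phi> x\<close> lies in the span of the other labels,
  which is a linear dependence.\<close>

lemma not_indep_if_in_span:
  assumes "S \<subseteq> ground M" "x \<in> S" "\<phi> x \<in> span (\<phi> ` (S - {x}))"
  shows "\<not> indep M S"
proof -
  have "finite S"
    using matroid assms(1) by (auto simp: matroid_def intro: finite_subset)
  moreover have "\<phi> ` S \<subseteq> carrier V"
    using labels assms(1) by auto
  ultimately show ?thesis
    using lin_dep_image_if_in_span[of S \<phi> x] assms indep_iff by blast
qed

lemma basis_spans: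
  assumes "Defs.basis M B" "x \<in> ground M"
  shows "\<phi> x \<in> span (\<phi> ` B)"
\<comment> \<open>A new label keeps \<open>\<phi>\<close> injective on \<open>insert x B\<close>, so
  the dependence forced by maximality of \<open>B\<close> must be a linear one.\<close>
proof (cases "\<phi> x \<in> \<phi> ` B")
  case True
  have "B \<subseteq> ground M"
    using matroid assms(1) by (auto simp: matroid_def Defs.basis_def)
  then have "\<phi> ` B \<subseteq> carrier V"
    using labels by auto
  then show ?thesis
    using True by (rule span_mem)
next
  case False
  have B: "B \<subseteq> ground M" "indep M B"
    using matroid assms(1) by (auto simp: matroid_def Defs.basis_def)
  then have li: "inj_on \<phi> B" "lin_indpt (\<phi> ` B)" "\<phi> ` B \<subseteq> carrier V" "\<phi> x \<in> carrier V"
    using indep_iff labels assms(2) by auto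
  have "x \<notin> B"
    using False by auto
  then have "\<not> indep M (insert x B)"
    using assms(1) unfolding Defs.basis_def by blast
  moreover have "inj_on \<phi> (insert x B)"
    using li(1) False by (simp add: image_iff)
  ultimately have "lin_dep (\<phi> ` insert x B)"
    using indep_iff[of "insert x B"] B assms(2) by auto
  then show ?thesis
    using lin_dep_iff_in_span[OF li(3,2,4) False] by simp
qed

lemma rank_bound_if_basis_avoids_loose_pair:
  assumes "finite (carrier K)" "Defs.basis M B" "e \<notin> B" "f \<notin> B" "e \<noteq> f" "loose k M e" "loose k M f"
  shows "rank M + 2 \<le> (card (carrier K) + 1) * (k + 1)"
proof -
  define W where "W = insert e (insert f B)"
  have ef: "e \<in> ground M" "f \<in> ground M"
    using assms by (auto simp: loose_def)
  have B: "B \<subseteq> ground M" "indep M B" "finite B"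
    using matroid assms(2) by (auto simp: matroid_def Defs.basis_def intro: finite_subset)
  have W: "W \<subseteq> ground M"
    using B ef by (auto simp: W_def)
  have img: "finite (\<phi> ` B)" "\<phi> ` B \<subseteq> carrier V" and efV: "\<phi> e \<in> carrier V" "\<phi> f \<in> carrier V"
    using B ef labels by auto
  obtain a where a: "a \<in> \<phi> ` B \<rightarrow> carrier K" "lincomb a (\<phi> ` B) = \<phi> e"
    using finite_in_span[OF img basis_spans[OF assms(2) ef(1)]] by blast
  obtain b where b: "b \<in> \<phi> ` B \<rightarrow> carrier K" "lincomb b (\<phi> ` B) = \<phi> f"
    using finite_in_span[OF img basis_spans[OF assms(2) ef(2)]] by blast
  have ab: "a (\<phi> x) \<in> carrier K" "b (\<phi> x) \<in> carrier K" if "x \<in> B" for x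
    using that a b by auto

  \<comment> \<open>The zero sets of the relation expressing \<open>f\<close> by \<open>B\<close> (index \<open>None\<close>) and of the
    relations expressing \<open>e + c f\<close> by \<open>B\<close> (index \<open>Some c\<close>).\<close>
  define Z where "Z = (\<lambda>i. case i of
      None \<Rightarrow> insert e {x \<in> B. b (\<phi> x) = \<zero>\<^bsub>K\<^esub>}
    | Some c \<Rightarrow> {x \<in> B. a (\<phi> x) \<oplus>\<^bsub>K\<^esub> c \<otimes>\<^bsub>K\<^esub> b (\<phi> x) = \<zero>\<^bsub>K\<^esub>} \<union> (if c = \<zero>\<^bsub>K\<^esub> then {f} else {}))"
  \<comment> \<open>The indices are the points of the projective line over \<open>K\<close>: one for
    each relation up to scalars.\<close>
  define I where "I = insert None (Some ` carrier K)"
  have ZW: "Z i \<subseteq> W" for i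
    by (auto simp: Z_def W_def split: option.splits if_splits)

  have cover: "W \<subseteq> (\<Union>i\<in>I. Z i)"
  proof
    fix x assume "x \<in> W"
    then consider "x = e" | "x = f" | "x \<in> B"
      by (auto simp: W_def)
    then show "x \<in> (\<Union>i\<in>I. Z i)"
    proof cases
      case 1
      then have "x \<in> Z None" by (simp add: Z_def)
      then show ?thesis by (auto simp: I_def)
    next
      \<comment> \<open>In the relation with index \<open>Some c\<close>, the coefficient of
        \<open>f\<close> is c up to sign, so it vanishes exactly for c = 0.\<close>
      case 2
      then have "x \<in> Z (Some \<zero>\<^bsub>K\<^esub>)" by (simp add: Z_def)
      then show ?thesis by (auto simp: I_def)
    next
      case 3
      show ?thesis
      proof (cases "b (\<phi> x) = \<zero>\<^bsub>K\<^esub>")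
        case True
        then have "x \<in> Z None" using 3 by (simp add: Z_def)
        then show ?thesis by (auto simp: I_def)
      next
        case False
        \<comment> \<open>The root of the linear equation a + c b = 0 for the coefficients at
          \<open>x\<close>.\<close>
        define c where "c = \<ominus>\<^bsub>K\<^esub> (a (\<phi> x) \<otimes>\<^bsub>K\<^esub> inv\<^bsub>K\<^esub> (b (\<phi> x)))"
        have unit: "b (\<phi> x) \<in> Units K"
          using False ab[OF 3] by (simp add: field_Units)
        then have inv: "inv\<^bsub>K\<^esub> (b (\<phi> x)) \<in> carrier K" "inv\<^bsub>K\<^esub> (b (\<phi> x)) \<otimes>\<^bsub>K\<^esub> b (\<phi> x) = \<one>\<^bsub>K\<^esub>"
          by auto
        have c: "c \<in> carrier K"
          using ab[OF 3] inv by (simp add: c_def)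
        have "c \<otimes>\<^bsub>K\<^esub> b (\<phi> x) = \<ominus>\<^bsub>K\<^esub> (a (\<phi> x))"
          using ab[OF 3] inv by (simp add: c_def R.l_minus R.m_assoc)
        then have "x \<in> Z (Some c)"
          using 3 ab[OF 3] by (simp add: Z_def R.r_neg)
        then show ?thesis using c by (auto simp: I_def)
      qed
    qed
  qed

  \<comment> \<open>\<open>W - Z i\<close> is the support of the relation. Solving the relation for
    \<open>f\<close> (index \<open>None\<close>) or \<open>e\<close> (index \<open>Some c\<close>)
    puts that label in the span of the rest of the support.\<close>
  have dep: "\<not> indep M (W - Z i)" if "i \<in> I" for i
  proof (cases i)
    case None
    have "b v \<noteq> \<zero>\<^bsub>K\<^esub> \<Longrightarrow> v \<in> \<phi> ` (W - Z i - {f})" if "v \<in> \<phi> ` B" for v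
      using that assms(3-5) None by (auto simp: Z_def W_def)
    then have "\<phi> f \<in> span (\<phi> ` (W - Z i - {f}))"
      unfolding b(2)[symmetric] by (rule lincomb_in_span_support[OF img b(1)]) (use W labels in auto)
    moreover have "f \<in> W - Z i"
      using None assms(4,5) by (auto simp: Z_def W_def)
    ultimately show ?thesis
      using not_indep_if_in_span[of "W - Z i" f] W by blast
  next
    case (Some c)
    then have c: "c \<in> carrier K"
      using that by (auto simp: I_def)
    let ?U = "\<phi> ` (W - Z i - {e})"
    have U: "?U \<subseteq> carrier V"
      using W labels by auto
    have cb: "(\<lambda>v. c \<otimes>\<^bsub>K\<^esub> b v) \<in> \<phi> ` B \<rightarrow> carrier K"
      using b(1) c by auto
    have sum_coeff: "(\<lambda>v. a v \<oplus>\<^bsub>K\<^esub> c \<otimes>\<^bsub>K\<^esub> b v) \<in> \<phi> ` B \<rightarrow> carrier K"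
      using ab c by auto
    have "a v \<oplus>\<^bsub>K\<^esub> c \<otimes>\<^bsub>K\<^esub> b v \<noteq> \<zero>\<^bsub>K\<^esub> \<Longrightarrow> v \<in> ?U" if "v \<in> \<phi> ` B" for v
      using that assms(3-5) Some by (auto simp: Z_def W_def)
    then have "lincomb (\<lambda>v. a v \<oplus>\<^bsub>K\<^esub> c \<otimes>\<^bsub>K\<^esub> b v) (\<phi> ` B) \<in> span ?U"
      by (rule lincomb_in_span_support[OF img sum_coeff _ U])
    moreover have "lincomb (\<lambda>v. a v \<oplus>\<^bsub>K\<^esub> c \<otimes>\<^bsub>K\<^esub> b v) (\<phi> ` B) = \<phi> e \<oplus>\<^bsub>V\<^esub> c \<odot>\<^bsub>V\<^esub> \<phi> f"
      using lincomb_sum[OF img a(1) cb] lincomb_smult[OF img(2) b(1) c] a(2) b(2) by simp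
    ultimately have sum: "c \<odot>\<^bsub>V\<^esub> \<phi> f \<oplus>\<^bsub>V\<^esub> \<phi> e \<in> span ?U"
      using efV c by (simp add: M.a_comm)
    \<comment> \<open>For nonzero c the element \<open>f\<close> is itself in the support; for c = 0
      the term vanishes. Removing it from \<open>sum\<close> leaves \<open>\<phi> e\<close>.\<close>
    have "c \<odot>\<^bsub>V\<^esub> \<phi> f \<in> span ?U"
    proof (cases "c = \<zero>\<^bsub>K\<^esub>")
      case True
      then show ?thesis using efV by (simp add: span_zero)
    next
      case False
      then have "\<phi> f \<in> ?U"
        using Some assms(4,5) by (auto simp: Z_def W_def)
      then show ?thesis
        using U c by (intro span_smult span_mem) auto
    qed
    then have "\<phi> e \<in> span ?U"
      using span_add[OF U _ efV(1)] sum by blast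
    moreover have "e \<in> W - Z i"
      using Some assms(3,5) by (auto simp: Z_def W_def)
    ultimately show ?thesis
      using not_indep_if_in_span[of "W - Z i" e] W by blast
  qed

  have small: "card (Z i) \<le> k + 1" if "i \<in> I" for i
  proof -
    have "card (W - (W - Z i)) \<le> k + 1"
      unfolding W_def
      by (rule card_outside_dependent_le[OF matroid assms(2-7)])
        (use dep[OF that] in \<open>auto simp: W_def\<close>)
    moreover have "W - (W - Z i) = Z i"
      using ZW by blast
    ultimately show ?thesis by simp
  qed
  have finI: "finite I" and cardI: "card I = card (carrier K) + 1"
    using assms(1) by (auto simp: I_def card_image)
  have finW: "finite W"
    using B by (simp add: W_def)
  have "rank M + 2 = card W"
    using basis_card_eq_rank[OF matroid assms(2)] B assms(3-5) by (simp add: W_def)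
  also have "\<dots> \<le> card (\<Union>i\<in>I. Z i)"
    using cover finI ZW finW by (intro card_mono) (auto intro: finite_subset)
  also have "\<dots> \<le> (\<Sum>i\<in>I. card (Z i))"
    using finI by (rule card_UN_le)
  also have "\<dots> \<le> (card (carrier K) + 1) * (k + 1)"
    using sum_bounded_above[of I "\<lambda>i. card (Z i)" "k + 1"] small cardI by simp
  finally show ?thesis .
qed

end

theorem theorem1p2:
  fixes q k :: nat
    and F :: "('f, 'm) ring_scheme"
    and M :: "'a set_system"
    and e f :: 'a
  assumes "primepow q"
    and "field F" and "card (carrier F) = q"
    and "representable_over F M"
    and "simple_matroid M"
    and "\<forall>x \<in> ground M. \<not> coloop M x"
    and "e \<noteq> f" and "loose k M e" and "loose k M f"
  shows "int (rank M) \<le> (int q + 1) * (int k - 1) + 2 * int q \<or> cocircuit M {e, f}"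
proof (rule disjCI)
  assume ncc: "\<not> cocircuit M {e, f}"
  have matroid: "matroid M"
    using assms(5) by (simp add: simple_matroid_def)
  obtain V :: "('f, nat \<Rightarrow> 'f) module" and \<phi> where
    V: "vectorspace F V" "\<phi> \<in> ground M \<rightarrow> carrier V"
      "\<forall>X\<subseteq>ground M. indep M X \<longleftrightarrow> inj_on \<phi> X \<and> \<not> module.lin_dep F V (\<phi> ` X)"
    using assms(4) unfolding representable_over_def by blast
  interpret vectorspace F V
    by (rule V(1))
  interpret represented_matroid F V M \<phi>
    by unfold_locales (use matroid V in auto)
  have ef: "e \<in> ground M" "f \<in> ground M"
    using assms(8,9) by (auto simp: loose_def)
  obtain B where B: "Defs.basis M B" "e \<notin> B" "f \<notin> B"
    using not_cocircuit_pair_imp_avoiding_basis[OF matroid ef] assms(6) ef ncc by blast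
  \<comment> \<open>An infinite set has \<open>card\<close> 0, whereas a prime power is
    positive.\<close>
  have "finite (carrier F)"
    using assms(1,3) by (auto intro: card_ge_0_finite simp: primepow_gt_0_nat)
  then have "rank M + 2 \<le> (q + 1) * (k + 1)"
    using rank_bound_if_basis_avoids_loose_pair[OF _ B assms(7-9)] assms(3) by simp
  then have "int (rank M + 2) \<le> int ((q + 1) * (k + 1))"
    by (rule zle_int[THEN iffD2])
  then show "int (rank M) \<le> (int q + 1) * (int k - 1) + 2 * int q"
    by (simp add: algebra_simps)
qed

end
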